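(* Let $U=U_1\times\cdots\times U_m$ be a Cartesian product of nonempty finite sets. A set $S\subseteq U$ is ample if and only if $\chi(S\cap V)=1$ for every full-dimensional subproduct $V$ of $U$ with $S\cap V\neq\varnothing$.
   Context: A full-dimensional subproduct (also called a box) of $U$ is a set $V=V_1\times\cdots\times V_m$ with $\varnothing\neq V_i\subseteq U_i$. The dimension of a box $B=B_1\times\cdots\times B_m$ is $\dim(B)=\sum_{i=1}^m(|B_i|-1)$. For $T\subseteq U$, $f_i(T)$ denotes the number of boxes of dimension $i$ contained in $T$, and $\chi(T)=\sum_{i\ge 0}(-1)^if_i(T)$ is the Euler characteristic. A generalized partition of $U$ is a tuple $\Lambda=(\alpha_1,\dots,\alpha_m)$ with $\alpha_i$ a partition of $U_i$ into nonempty blocks; it defines a partition of $U$ into the boxes $P^1\times\cdots\times P^m$, $P^i\in\alpha_i$, and the minor-subproduct $M(\Lambda)=M_1\times\cdots\times M_m$, where $M_i$ is the set of blocks of $\alpha_i$. $M(\Lambda)$ is shattered by $S\subseteq U$ if $S$ meets every box of the box-partition. A copy of $M(\Lambda)$ is a set $W_1\times\cdots\times W_m$ where $W_i$ consists of exactly one element from each block of $\alpha_i$. $M(\Lambda)$ is strongly shattered by $S$ if $S$ contains a copy of it. $S$ is ample if every minor-subproduct of $U$ shattered by $S$ is strongly shattered by $S$. *)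

theory Defs
  imports Main "HOL-Library.FuncSet" "HOL-Library.Disjoint_Sets" "HOL-Library.Groups_Big_Fun"
begin

text \<open>
  The product \<open>U\<^sub>1 \<times> \<dots> \<times> U\<^sub>m\<close> is the extensional function space \<open>\<Pi>\<^sub>E i\<in>{1..m}. U i\<close>;
  the values of \<open>U\<close> outside \<open>{1..m}\<close> are irrelevant.
\<close>

definition subfactors :: "nat \<Rightarrow> (nat \<Rightarrow> 'a set) \<Rightarrow> (nat \<Rightarrow> 'a set) \<Rightarrow> bool" where
  "subfactors m U B \<longleftrightarrow> (\<forall>i\<in>{1..m}. B i \<noteq> {} \<and> B i \<subseteq> U i)"

definition full_dim_subproduct :: "nat \<Rightarrow> (nat \<Rightarrow> 'a set) \<Rightarrow> (nat \<Rightarrow> 'a) set \<Rightarrow> bool" where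
  "full_dim_subproduct m U V \<longleftrightarrow> (\<exists>B. subfactors m U B \<and> V = (\<Pi>\<^sub>E i\<in>{1..m}. B i))"

text \<open>
  The dimension is attached to the factors of a box; since the factors are nonempty, the box
  determines them. The truncated subtraction is harmless for nonempty finite \<open>B i\<close>.
\<close>

definition box_dim :: "nat \<Rightarrow> (nat \<Rightarrow> 'a set) \<Rightarrow> nat" where
  "box_dim m B = (\<Sum>i\<in>{1..m}. card (B i) - 1)"

definition box_count :: "nat \<Rightarrow> (nat \<Rightarrow> 'a set) \<Rightarrow> nat \<Rightarrow> (nat \<Rightarrow> 'a) set \<Rightarrow> nat" where
  "box_count m U d T =
     card {(\<Pi>\<^sub>E i\<in>{1..m}. B i) | B.
             subfactors m U B \<and> box_dim m B = d \<and> (\<Pi>\<^sub>E i\<in>{1..m}. B i) \<subseteq> T}"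

text \<open>
  \<open>Sum_any\<close> sums over all \<open>d \<ge> 0\<close>; only finitely many terms are nonzero when the
  \<open>U i\<close> are finite.
\<close>

definition euler_char :: "nat \<Rightarrow> (nat \<Rightarrow> 'a set) \<Rightarrow> (nat \<Rightarrow> 'a) set \<Rightarrow> int" where
  "euler_char m U T = Sum_any (\<lambda>d. (- 1) ^ d * int (box_count m U d T))"

definition generalized_partition :: "nat \<Rightarrow> (nat \<Rightarrow> 'a set) \<Rightarrow> (nat \<Rightarrow> 'a set set) \<Rightarrow> bool" where
  "generalized_partition m U \<alpha> \<longleftrightarrow> (\<forall>i\<in>{1..m}. partition_on (U i) (\<alpha> i))"

text \<open>
  An element \<open>P\<close> of the minor-subproduct is a choice of one block per coordinate; it stands for
  the box \<open>\<Pi>\<^sub>E i\<in>{1..m}. P i\<close> of the associated partition of \<open>U\<close> into boxes.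
\<close>

definition minor_subproduct :: "nat \<Rightarrow> (nat \<Rightarrow> 'a set set) \<Rightarrow> (nat \<Rightarrow> 'a set) set" where
  "minor_subproduct m \<alpha> = (\<Pi>\<^sub>E i\<in>{1..m}. \<alpha> i)"

definition shattered :: "nat \<Rightarrow> (nat \<Rightarrow> 'a set set) \<Rightarrow> (nat \<Rightarrow> 'a) set \<Rightarrow> bool" where
  "shattered m \<alpha> S \<longleftrightarrow> (\<forall>P\<in>minor_subproduct m \<alpha>. S \<inter> (\<Pi>\<^sub>E i\<in>{1..m}. P i) \<noteq> {})"

definition minor_copy ::
  "nat \<Rightarrow> (nat \<Rightarrow> 'a set) \<Rightarrow> (nat \<Rightarrow> 'a set set) \<Rightarrow> (nat \<Rightarrow> 'a) set \<Rightarrow> bool" where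
  "minor_copy m U \<alpha> C \<longleftrightarrow>
     (\<exists>W. (\<forall>i\<in>{1..m}. W i \<subseteq> U i \<and> (\<forall>P\<in>\<alpha> i. \<exists>!x. x \<in> W i \<inter> P)) \<and>
          C = (\<Pi>\<^sub>E i\<in>{1..m}. W i))"

definition strongly_shattered ::
  "nat \<Rightarrow> (nat \<Rightarrow> 'a set) \<Rightarrow> (nat \<Rightarrow> 'a set set) \<Rightarrow> (nat \<Rightarrow> 'a) set \<Rightarrow> bool" where
  "strongly_shattered m U \<alpha> S \<longleftrightarrow> (\<exists>C. minor_copy m U \<alpha> C \<and> C \<subseteq> S)"

definition ample :: "nat \<Rightarrow> (nat \<Rightarrow> 'a set) \<Rightarrow> (nat \<Rightarrow> 'a) set \<Rightarrow> bool" where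
  "ample m U S \<longleftrightarrow>
     (\<forall>\<alpha>. generalized_partition m U \<alpha> \<longrightarrow> shattered m \<alpha> S \<longrightarrow> strongly_shattered m U \<alpha> S)"

end

theory Submission
  imports Defs
begin

text \<open>
  Both directions go by induction on \<open>\<Sum>\<^sub>i |U\<^sub>i|\<close>. For \<open>x \<in> U\<^sub>i\<close> let \<open>V\<close> be \<open>U\<close> with \<open>x\<close> removed from
  the \<open>i\<close>-th factor, \<open>X\<close> the slice of \<open>U\<close> over \<open>x\<close>, and \<open>T\<close> the link of \<open>x\<close>, consisting of the
  \<open>s \<in> S\<close> with \<open>s(i := x) \<in> S\<close>. Then \<open>\<chi>(S) = \<chi>(S \<inter> V) + \<chi>(S \<inter> X) - \<chi>(T \<inter> V)\<close>.

  If \<open>S\<close> is ample, then so are \<open>S \<inter> V\<close>, \<open>S \<inter> X\<close> and \<open>T \<inter> V\<close>, and \<open>T \<inter> V\<close> is nonempty as soon as the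
  other two are; hence \<open>\<chi>(S) = 1\<close>. Conversely, if \<open>\<chi>\<close> is \<open>1\<close> on all nonempty intersections of \<open>S\<close> with
  boxes, then \<open>T\<close> inherits this property in \<open>V\<close>, and \<open>T\<close> meets a box \<open>B \<subseteq> V\<close> whenever \<open>S\<close> meets both
  \<open>B\<close> and its translate \<open>B(i := {x})\<close>. This allows a copy found in \<open>T\<close> to be extended by \<open>x\<close>.
\<close>

declare One_nat_def [simp del]

section \<open>The Euler characteristic as a sum over boxes\<close>

text \<open>Boxes are encoded by their factor functions, extensional so that each box has exactly
  one code. Single factors can then be updated.\<close>

definition boxes :: "nat \<Rightarrow> (nat \<Rightarrow> 'a set) \<Rightarrow> (nat \<Rightarrow> 'a) set \<Rightarrow> (nat \<Rightarrow> 'a set) set" where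
  "boxes m U S = {B \<in> (\<Pi>\<^sub>E i\<in>{1..m}. Pow (U i) - {{}}). (\<Pi>\<^sub>E i\<in>{1..m}. B i) \<subseteq> S}"

text \<open>This is the Euler characteristic of the part of \<open>S\<close> inside the product of
  the \<open>U i\<close>; \<open>S\<close> itself may stick out of it. Shrinking \<open>U\<close>
  thus replaces intersecting \<open>S\<close> with a box.\<close>

definition box_sum :: "nat \<Rightarrow> (nat \<Rightarrow> 'a set) \<Rightarrow> (nat \<Rightarrow> 'a) set \<Rightarrow> int" where
  "box_sum m U S = (\<Sum>B\<in>boxes m U S. (- 1) ^ box_dim m B)"

text \<open>All \<open>s \<in> S\<close> with \<open>s i = x\<close> belong to the link; passing to
  the factors \<open>U(i := U i - {x})\<close> cuts them off.\<close>

definition link :: "nat \<Rightarrow> 'a \<Rightarrow> (nat \<Rightarrow> 'a) set \<Rightarrow> (nat \<Rightarrow> 'a) set" where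
  "link i x S = {s \<in> S. s(i := x) \<in> S}"

lemma boxes_iff:
  "B \<in> boxes m U S \<longleftrightarrow> B \<in> extensional {1..m} \<and> (\<forall>i\<in>{1..m}. B i \<noteq> {} \<and> B i \<subseteq> U i) \<and>
    (\<Pi>\<^sub>E i\<in>{1..m}. B i) \<subseteq> S"
  unfolding boxes_def PiE_iff by blast

lemma boxes_upd_iff:
  assumes "i \<in> {1..m}" "A \<subseteq> U i"
  shows "B \<in> boxes m (U(i := A)) S \<longleftrightarrow> B \<in> boxes m U S \<and> B i \<subseteq> A"
proof -
  have "(\<forall>j\<in>{1..m}. B j \<noteq> {} \<and> B j \<subseteq> (U(i := A)) j) \<longleftrightarrow>
      (\<forall>j\<in>{1..m}. B j \<noteq> {} \<and> B j \<subseteq> U j) \<and> B i \<subseteq> A"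
    using assms by (auto split: if_splits)
  then show ?thesis
    unfolding boxes_iff by blast
qed

lemma finite_boxes:
  assumes "\<And>i. i \<in> {1..m} \<Longrightarrow> finite (U i)"
  shows "finite (boxes m U S)"
proof -
  have "finite (\<Pi>\<^sub>E i\<in>{1..m}. Pow (U i) - {{}})"
    using assms by (intro finite_PiE) auto
  then show ?thesis
    unfolding boxes_def by simp
qed

lemma PiE_subset_factors:
  assumes "(\<Pi>\<^sub>E i\<in>I. B i) \<subseteq> (\<Pi>\<^sub>E i\<in>I. C i)" "\<And>i. i \<in> I \<Longrightarrow> B i \<noteq> {}" "i \<in> I"
  shows "B i \<subseteq> C i"
  using assms unfolding subset_PiE by (auto simp: PiE_eq_empty_iff)

text \<open>A nonempty box lies in a product only if each of its factors lies in the corresponding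
  factor, so a condition on the set becomes one on the factors.\<close>

lemma boxes_Int:
  assumes "subfactors m U V"
  shows "boxes m U (S \<inter> (\<Pi>\<^sub>E i\<in>{1..m}. V i)) = boxes m V S"
proof (intro set_eqI iffI)
  fix B
  assume B: "B \<in> boxes m U (S \<inter> (\<Pi>\<^sub>E i\<in>{1..m}. V i))"
  then have ne: "\<And>i. i \<in> {1..m} \<Longrightarrow> B i \<noteq> {}"
    by (fastforce simp: boxes_def PiE_iff)
  have "(\<Pi>\<^sub>E i\<in>{1..m}. B i) \<subseteq> (\<Pi>\<^sub>E i\<in>{1..m}. V i)"
    using B by (simp add: boxes_def)
  from PiE_subset_factors[OF this ne] have "\<And>i. i \<in> {1..m} \<Longrightarrow> B i \<subseteq> V i" .
  then show "B \<in> boxes m V S"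
    using B ne by (auto simp: boxes_def PiE_iff)
next
  fix B
  assume B: "B \<in> boxes m V S"
  then have "(\<Pi>\<^sub>E i\<in>{1..m}. B i) \<subseteq> (\<Pi>\<^sub>E i\<in>{1..m}. V i)"
    by (intro PiE_mono) (auto simp: boxes_def PiE_iff)
  moreover have "B \<in> (\<Pi>\<^sub>E i\<in>{1..m}. Pow (U i) - {{}})"
    using B assms unfolding boxes_def PiE_iff subfactors_def by blast
  ultimately show "B \<in> boxes m U (S \<inter> (\<Pi>\<^sub>E i\<in>{1..m}. V i))"
    using B by (auto simp: boxes_def)
qed

text \<open>Nonempty factors can be recovered from their product, and restricting a factor function
  to \<open>{1..m}\<close> changes neither product nor dimension. Hence counting sets and counting
  codes agree.\<close>

lemma box_count_eq_card_boxes: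
  "box_count m U d T = card {B \<in> boxes m U T. box_dim m B = d}"
proof -
  let ?F = "\<lambda>B. \<Pi>\<^sub>E i\<in>{1..m}. B i"
  have inj: "inj_on ?F {B \<in> boxes m U T. box_dim m B = d}"
  proof (rule inj_onI)
    fix B C
    assume B: "B \<in> {B \<in> boxes m U T. box_dim m B = d}"
      and C: "C \<in> {B \<in> boxes m U T. box_dim m B = d}" and eq: "?F B = ?F C"
    have ext: "B \<in> extensional {1..m}" "C \<in> extensional {1..m}"
      using B C by (auto simp: boxes_def PiE_iff)
    have ne: "\<And>i. i \<in> {1..m} \<Longrightarrow> B i \<noteq> {}" "\<And>i. i \<in> {1..m} \<Longrightarrow> C i \<noteq> {}"
      using B C by (fastforce simp: boxes_def PiE_iff)+
    have "B i = C i" if "i \<in> {1..m}" for i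
      using PiE_subset_factors[of "{1..m}" B C i] PiE_subset_factors[of "{1..m}" C B i] eq ne that
      by blast
    then show "B = C"
      using ext by (intro extensionalityI) auto
  qed
  have "{?F B | B. subfactors m U B \<and> box_dim m B = d \<and> ?F B \<subseteq> T}
      = ?F ` {B \<in> boxes m U T. box_dim m B = d}" (is "?L = ?R")
  proof (intro subset_antisym subsetI)
    fix b
    assume "b \<in> ?L"
    then obtain B where B: "b = ?F B" "subfactors m U B" "box_dim m B = d" "?F B \<subseteq> T"
      by blast
    let ?B = "restrict B {1..m}"
    have "?F ?B = ?F B"
      by (intro PiE_cong) simp
    moreover have "box_dim m ?B = box_dim m B"
      unfolding box_dim_def by (intro sum.cong) auto
    ultimately show "b \<in> ?R"
      using B by (intro image_eqI[of _ _ ?B]) (auto simp: boxes_def subfactors_def PiE_iff)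
  next
    fix b
    assume "b \<in> ?R"
    then obtain B where "b = ?F B" "B \<in> boxes m U T" "box_dim m B = d"
      by blast
    moreover from this have "subfactors m U B" "?F B \<subseteq> T"
      unfolding boxes_def subfactors_def PiE_iff by blast+
    ultimately show "b \<in> ?L"
      by blast
  qed
  then show ?thesis
    unfolding box_count_def using card_image[OF inj] by simp
qed

text \<open>Group the boxes by dimension; dimensions attained by no box contribute nothing, which
  makes the sum over all \<open>d\<close> finite.\<close>

lemma euler_char_eq_box_sum:
  assumes fin: "\<And>i. i \<in> {1..m} \<Longrightarrow> finite (U i)" and V: "subfactors m U V"
  shows "euler_char m U (S \<inter> (\<Pi>\<^sub>E i\<in>{1..m}. V i)) = box_sum m V S"
proof -
  let ?T = "S \<inter> (\<Pi>\<^sub>E i\<in>{1..m}. V i)"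
  let ?D = "box_dim m ` boxes m U ?T"
  have finB: "finite (boxes m U ?T)"
    using finite_boxes fin by blast
  have "euler_char m U ?T = (\<Sum>d\<in>?D. (- 1) ^ d * int (box_count m U d ?T))"
    unfolding euler_char_def
  proof (rule Sum_any.expand_superset)
    show "finite ?D"
      using finB by simp
    show "{d. (- 1) ^ d * int (box_count m U d ?T) \<noteq> 0} \<subseteq> ?D"
    proof
      fix d
      assume "d \<in> {d. (- 1) ^ d * int (box_count m U d ?T) \<noteq> 0}"
      then have "card {B \<in> boxes m U ?T. box_dim m B = d} \<noteq> 0"
        by (simp add: box_count_eq_card_boxes)
      then have "{B \<in> boxes m U ?T. box_dim m B = d} \<noteq> {}"
        by (metis card.empty)
      then show "d \<in> ?D"
        by auto
    qed
  qed
  also have "\<dots> = (\<Sum>d\<in>?D. \<Sum>B\<in>{B \<in> boxes m U ?T. box_dim m B = d}. (- 1) ^ box_dim m B)"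
    by (intro sum.cong) (simp_all add: box_count_eq_card_boxes)
  also have "\<dots> = box_sum m V S"
    unfolding box_sum_def boxes_Int[OF V, symmetric]
    by (rule sum.image_gen[OF finB, symmetric])
  finally show ?thesis .
qed

text \<open>Every box contains a point. Contrapositively, a nonzero \<open>box_sum\<close> certifies
  that \<open>S\<close> meets the product.\<close>

lemma box_sum_empty:
  assumes "S \<inter> (\<Pi>\<^sub>E i\<in>{1..m}. U i) = {}"
  shows "box_sum m U S = 0"
proof -
  have "boxes m U S = {}"
  proof (rule equals0I)
    fix B
    assume B: "B \<in> boxes m U S"
    then have "(\<Pi>\<^sub>E i\<in>{1..m}. B i) \<subseteq> (\<Pi>\<^sub>E i\<in>{1..m}. U i)"
      by (intro PiE_mono) (auto simp: boxes_def PiE_iff)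
    moreover have "(\<Pi>\<^sub>E i\<in>{1..m}. B i) \<subseteq> S"
      using B by (simp add: boxes_def)
    moreover have "(\<Pi>\<^sub>E i\<in>{1..m}. B i) \<noteq> {}"
      using B unfolding PiE_eq_empty_iff boxes_def PiE_iff by blast
    ultimately show False
      using assms by blast
  qed
  then show ?thesis
    by (simp add: box_sum_def)
qed

section \<open>Recursion of the Euler characteristic along a point of one factor\<close>

text \<open>Every point of the enlarged box either lies in the box of \<open>B\<close> or arises
  from a point of that box by setting coordinate \<open>i\<close> to \<open>x\<close>.\<close>

lemma box_insert_subset_iff:
  assumes "i \<in> {1..m}" "B i \<noteq> {}"
  shows "(\<Pi>\<^sub>E j\<in>{1..m}. (B(i := insert x (B i))) j) \<subseteq> S \<longleftrightarrow>
    (\<Pi>\<^sub>E j\<in>{1..m}. B j) \<subseteq> link i x S" (is "?L \<subseteq> S \<longleftrightarrow> ?R \<subseteq> _")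
proof
  assume L: "?L \<subseteq> S"
  show "?R \<subseteq> link i x S"
  proof
    fix s
    assume "s \<in> ?R"
    then have "s \<in> ?L" "s(i := x) \<in> ?L"
      using assms(1) by (auto simp: PiE_iff extensional_def)
    then show "s \<in> link i x S"
      using L by (auto simp: link_def)
  qed
next
  assume R: "?R \<subseteq> link i x S"
  show "?L \<subseteq> S"
  proof
    fix s
    assume s: "s \<in> ?L"
    show "s \<in> S"
    proof (cases "s i \<in> B i")
      case True
      then have "s \<in> ?R"
        using s by (auto simp: PiE_iff split: if_splits)
      then show ?thesis
        using R by (auto simp: link_def)
    next
      case False
      \<comment> \<open>Any element of \<open>B i\<close> serves: overwriting coordinate
        \<open>i\<close> by \<open>z\<close> leads into the box, and the link condition leads back
        to \<open>s\<close>.\<close>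
      obtain z where z: "z \<in> B i"
        using assms(2) by blast
      have "s i \<in> insert x (B i)"
        using PiE_mem[OF s assms(1)] by simp
      then have [simp]: "s i = x"
        using False by simp
      have "s(i := z) \<in> ?R"
        using s z assms(1) by (auto simp: PiE_iff extensional_def split: if_splits)
      then have "s(i := z, i := x) \<in> S"
        using R unfolding link_def by blast
      moreover have "s(i := z, i := x) = s"
        by auto
      ultimately show ?thesis
        by simp
    qed
  qed
qed

text \<open>Adding a new element to a factor thus flips the sign of the box in
  \<open>box_sum\<close>.\<close>

lemma box_dim_insert:
  assumes "i \<in> {1..m}" "finite (B i)" "B i \<noteq> {}" "x \<notin> B i"
  shows "box_dim m (B(i := insert x (B i))) = Suc (box_dim m B)"
proof -
  let ?C = "B(i := insert x (B i))"
  have "box_dim m ?C = (card (?C i) - 1) + (\<Sum>j\<in>{1..m}-{i}. card (?C j) - 1)"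
    unfolding box_dim_def using assms(1) by (intro sum.remove) auto
  also have "(\<Sum>j\<in>{1..m}-{i}. card (?C j) - 1) = (\<Sum>j\<in>{1..m}-{i}. card (B j) - 1)"
    by (intro sum.cong) auto
  \<comment> \<open>Nonemptiness of \<open>B i\<close> matters here: with truncated subtraction, the
    empty set and a singleton both give 0.\<close>
  also have "card (?C i) - 1 = Suc (card (B i) - 1)"
    using assms by (simp add: card_gt_0_iff)
  finally show ?thesis
    unfolding box_dim_def using sum.remove[OF _ assms(1), of "\<lambda>j. card (B j) - 1"] by simp
qed

text \<open>A box containing \<open>x\<close> in coordinate \<open>i\<close> either has \<open>{x}\<close> as its \<open>i\<close>-th factor or is obtained
  from a box of the link, of dimension one less, by adding \<open>x\<close> to that factor.\<close>

lemma box_sum_split: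
  assumes fin: "\<And>i. i \<in> {1..m} \<Longrightarrow> finite (U i)" and i: "i \<in> {1..m}" and x: "x \<in> U i"
  shows "box_sum m U S = box_sum m (U(i := U i - {x})) S + box_sum m (U(i := {x})) S
    - box_sum m (U(i := U i - {x})) (link i x S)"
proof -
  let ?V = "U(i := U i - {x})"
  let ?sgn = "\<lambda>B. (- 1 :: int) ^ box_dim m B"
  let ?h = "\<lambda>B. B(i := insert x (B i))"
  let ?F = "boxes m ?V S" and ?G = "boxes m (U(i := {x})) S" and ?L = "boxes m ?V (link i x S)"
  have finite: "finite ?F" "finite ?G" "finite ?L"
    using fin by (auto intro!: finite_boxes split: if_splits)
  \<comment> \<open>\<open>F\<close>, \<open>G\<close> and \<open>H\<close> sort the boxes by their
    factor \<open>B i\<close>: without \<open>x\<close>, equal to \<open>{x}\<close>, or containing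
    \<open>x\<close> and something else.\<close>
  have F: "B \<in> ?F \<longleftrightarrow> B \<in> boxes m U S \<and> x \<notin> B i" for B
    using i boxes_upd_iff[OF i, of "U i - {x}" U B S] by (auto simp: boxes_iff)
  have ne: "B i \<noteq> {}" if "B \<in> boxes m U S'" for B S'
    using that i unfolding boxes_iff by blast
  have G: "B \<in> ?G \<longleftrightarrow> B \<in> boxes m U S \<and> B i = {x}" for B
    using boxes_upd_iff[OF i, of "{x}" U B S] x ne[of B S] by blast
  have L: "B \<in> boxes m U (link i x S) \<and> B i \<noteq> {} \<and> x \<notin> B i \<and> B i \<subseteq> U i" if "B \<in> ?L" for B
    using that boxes_upd_iff[OF i, of "U i - {x}" U B "link i x S"] ne[of B "link i x S"] by blast
  have H: "B \<in> ?h ` ?L \<longleftrightarrow> B \<in> boxes m U S \<and> x \<in> B i \<and> B i \<noteq> {x}" (is "_ \<longleftrightarrow> ?Q") for B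
  proof
    assume "B \<in> ?h ` ?L"
    then obtain C where C: "C \<in> ?L" and B: "B = ?h C"
      by blast
    have "(\<Pi>\<^sub>E j\<in>{1..m}. B j) \<subseteq> S"
      unfolding B using box_insert_subset_iff[OF i, of C x S] L[OF C] by (simp add: boxes_iff)
    moreover have "B \<in> extensional {1..m}" "\<forall>j\<in>{1..m}. B j \<noteq> {} \<and> B j \<subseteq> U j"
      using L[OF C] i x unfolding B boxes_iff by (auto simp: extensional_def)
    ultimately have "B \<in> boxes m U S"
      unfolding boxes_iff by blast
    then show ?Q
      using L[OF C] unfolding B by auto
  next
    assume Q: ?Q
    let ?C = "B(i := B i - {x})"
    have hC: "?h ?C = B"
      using Q by (auto simp: insert_absorb)
    have "?C i \<noteq> {}"
      using Q by auto
    then have "(\<Pi>\<^sub>E j\<in>{1..m}. ?C j) \<subseteq> link i x S"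
      using box_insert_subset_iff[OF i, of ?C x S] Q unfolding hC boxes_iff by simp
    moreover have "?C \<in> extensional {1..m}" "\<forall>j\<in>{1..m}. ?C j \<noteq> {} \<and> ?C j \<subseteq> ?V j"
      using Q i \<open>?C i \<noteq> {}\<close> unfolding boxes_iff by (auto simp: extensional_def)
    ultimately have "?C \<in> ?L"
      unfolding boxes_iff by blast
    then show "B \<in> ?h ` ?L"
      by (rule image_eqI[where f = ?h, OF hC[symmetric]])
  qed
  have inj: "inj_on ?h ?L"
  proof (rule inj_onI)
    fix B C
    assume B: "B \<in> ?L" and C: "C \<in> ?L" and eq: "?h B = ?h C"
    have "B j = C j" for j
    proof (cases "j = i")
      case True
      have "insert x (B i) = insert x (C i)"
        using fun_cong[OF eq, of i] by simp
      then show ?thesis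
        using L[OF B] L[OF C] True by (metis insert_ident)
    next
      case False
      then show ?thesis
        using fun_cong[OF eq, of j] by simp
    qed
    then show "B = C" ..
  qed
  have "boxes m U S = (?F \<union> ?G) \<union> ?h ` ?L"
    by (rule set_eqI) (simp only: Un_iff F G H, blast)
  moreover have "?F \<inter> ?G = {}" "(?F \<union> ?G) \<inter> ?h ` ?L = {}"
    by (rule equals0I, simp only: Int_iff Un_iff F G H, blast)+
  ultimately have "box_sum m U S = sum ?sgn ?F + sum ?sgn ?G + sum ?sgn (?h ` ?L)"
    unfolding box_sum_def using finite by (simp add: sum.union_disjoint)
  \<comment> \<open>The shift of dimension by one is the source of the minus sign in front of the
    link term.\<close>
  also have "sum ?sgn (?h ` ?L) = (\<Sum>B\<in>?L. - ?sgn B)"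
  proof -
    have "?sgn (?h B) = - ?sgn B" if "B \<in> ?L" for B
    proof -
      have "finite (B i)"
        using L[OF that] fin[OF i] finite_subset by blast
      then show ?thesis
        using box_dim_insert[of i m B x] i L[OF that] by simp
    qed
    then show ?thesis
      by (simp add: sum.reindex[OF inj])
  qed
  finally show ?thesis
    unfolding box_sum_def sum_negf by linarith
qed

text \<open>Start of the induction: the product is a single point, whose only box is itself, of
  dimension 0.\<close>

lemma box_sum_point:
  assumes "\<And>i. i \<in> {1..m} \<Longrightarrow> \<exists>a. U i = {a}" "S \<inter> (\<Pi>\<^sub>E i\<in>{1..m}. U i) \<noteq> {}"
  shows "box_sum m U S = 1"
proof -
  have "\<forall>i\<in>{1..m}. \<exists>a. U i = {a}"
    using assms(1) by blast
  from bchoice[OF this] obtain u where u: "\<And>i. i \<in> {1..m} \<Longrightarrow> U i = {u i}"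
    by blast
  have "(\<Pi>\<^sub>E i\<in>{1..m}. Pow (U i) - {{}}) = (\<Pi>\<^sub>E i\<in>{1..m}. {U i})"
    by (intro PiE_cong) (auto simp: u)
  also have "\<dots> = (\<Pi>\<^sub>E i\<in>{1..m}. {restrict U {1..m} i})"
    by (intro PiE_cong) simp
  also have "\<dots> = {restrict U {1..m}}"
    by (intro PiE_singleton restrict_extensional)
  finally have eq: "(\<Pi>\<^sub>E i\<in>{1..m}. Pow (U i) - {{}}) = {restrict U {1..m}}" .
  have "(\<Pi>\<^sub>E i\<in>{1..m}. U i) = (\<Pi>\<^sub>E i\<in>{1..m}. {restrict u {1..m} i})"
    by (intro PiE_cong) (simp add: u)
  also have "\<dots> = {restrict u {1..m}}"
    by (intro PiE_singleton restrict_extensional)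
  finally have "(\<Pi>\<^sub>E i\<in>{1..m}. U i) \<subseteq> S"
    using assms(2) by auto
  moreover have "(\<Pi>\<^sub>E i\<in>{1..m}. restrict U {1..m} i) = (\<Pi>\<^sub>E i\<in>{1..m}. U i)"
    by (intro PiE_cong) simp
  ultimately have "boxes m U S = {restrict U {1..m}}"
    unfolding boxes_def eq by blast
  moreover have "box_dim m (restrict U {1..m}) = 0"
    unfolding box_dim_def by (simp add: u)
  ultimately show ?thesis
    by (simp add: box_sum_def)
qed

section \<open>Ampleness of subproducts and links\<close>

lemma PiE_meet:
  assumes "\<And>i. i \<in> I \<Longrightarrow> A i \<inter> B i \<noteq> {}"
  shows "(\<Pi>\<^sub>E i\<in>I. A i) \<inter> (\<Pi>\<^sub>E i\<in>I. B i) \<noteq> {}"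
  using assms by (simp add: PiE_Int PiE_eq_empty_iff)

text \<open>A point \<open>s\<close> of the link in the box provides two points of \<open>S\<close>:
  \<open>s\<close> in the box and \<open>s(i := x)\<close> in its translate.\<close>

lemma link_meet:
  assumes "i \<in> {1..m}" "link i x S \<inter> (\<Pi>\<^sub>E j\<in>{1..m}. B j) \<noteq> {}"
  shows "S \<inter> (\<Pi>\<^sub>E j\<in>{1..m}. B j) \<noteq> {}" "S \<inter> (\<Pi>\<^sub>E j\<in>{1..m}. (B(i := {x})) j) \<noteq> {}"
proof -
  obtain s where s: "s \<in> S" "s(i := x) \<in> S" "s \<in> (\<Pi>\<^sub>E j\<in>{1..m}. B j)"
    using assms(2) by (auto simp: link_def)
  then show "S \<inter> (\<Pi>\<^sub>E j\<in>{1..m}. B j) \<noteq> {}"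
    by blast
  have "s(i := x) \<in> (\<Pi>\<^sub>E j\<in>{1..m}. (B(i := {x})) j)"
    using s(3) assms(1) by (auto simp: PiE_iff extensional_def)
  then show "S \<inter> (\<Pi>\<^sub>E j\<in>{1..m}. (B(i := {x})) j) \<noteq> {}"
    using s(2) by blast
qed

section \<open>Partitions, shattering and transversals\<close>

lemma partition_on_insert_new:
  assumes "partition_on A P" "D \<inter> A = {}" "D \<noteq> {}"
  shows "partition_on (A \<union> D) (insert D P)"
proof -
  have "disjnt D (\<Union>P)" "(A \<union> D) - D = A"
    using assms by (auto simp: disjnt_def partition_on_def)
  then show ?thesis
    using assms by (simp add: partition_on_insert)
qed

lemma partition_on_remove:
  assumes "partition_on A P" "Q \<in> P"
  shows "partition_on (A - Q) (P - {Q})"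
proof -
  have "disjnt Q (\<Union>(P - {Q}))"
    using partition_onD2[OF assms(1)] assms(2) by (auto simp: disjnt_def pairwise_def)
  from partition_on_insert[OF this, of A] show ?thesis
    using assms by (simp add: insert_absorb)
qed

lemma generalized_partition_upd:
  assumes "generalized_partition m U \<alpha>" "partition_on A \<gamma>"
  shows "generalized_partition m (U(i := A)) (\<alpha>(i := \<gamma>))"
  using assms by (auto simp: generalized_partition_def)

text \<open>Restricting \<open>P\<close> to \<open>{1..m}\<close> leaves the product unchanged, so
  blocks may be chosen by arbitrary functions and exchanged one coordinate at a time.\<close>

lemma shattered_iff:
  "shattered m \<alpha> S \<longleftrightarrow>
    (\<forall>P. (\<forall>i\<in>{1..m}. P i \<in> \<alpha> i) \<longrightarrow> S \<inter> (\<Pi>\<^sub>E i\<in>{1..m}. P i) \<noteq> {})" (is "_ \<longleftrightarrow> ?R")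
proof
  assume L: "shattered m \<alpha> S"
  show ?R
  proof (intro allI impI)
    fix P
    assume "\<forall>i\<in>{1..m}. P i \<in> \<alpha> i"
    then have "restrict P {1..m} \<in> minor_subproduct m \<alpha>"
      by (auto simp: minor_subproduct_def)
    then have "S \<inter> (\<Pi>\<^sub>E i\<in>{1..m}. restrict P {1..m} i) \<noteq> {}"
      using L by (auto simp only: shattered_def)
    moreover have "(\<Pi>\<^sub>E i\<in>{1..m}. restrict P {1..m} i) = (\<Pi>\<^sub>E i\<in>{1..m}. P i)"
      by (intro PiE_cong) simp
    ultimately show "S \<inter> (\<Pi>\<^sub>E i\<in>{1..m}. P i) \<noteq> {}"
      by simp
  qed
next
  assume ?R
  then show "shattered m \<alpha> S"
    by (auto simp only: shattered_def minor_subproduct_def PiE_iff)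
qed

lemma shatteredD:
  assumes "shattered m \<alpha> S" "\<And>i. i \<in> {1..m} \<Longrightarrow> P i \<in> \<alpha> i"
  shows "S \<inter> (\<Pi>\<^sub>E i\<in>{1..m}. P i) \<noteq> {}"
  using assms unfolding shattered_iff by blast

text \<open>The factors of a copy are kept apart from their product, so that single factors can be
  modified.\<close>

definition transversals ::
  "nat \<Rightarrow> (nat \<Rightarrow> 'a set) \<Rightarrow> (nat \<Rightarrow> 'a set set) \<Rightarrow> (nat \<Rightarrow> 'a set) \<Rightarrow> bool" where
  "transversals m U \<alpha> W \<longleftrightarrow>
    (\<forall>i\<in>{1..m}. W i \<subseteq> U i \<and> (\<forall>Q\<in>\<alpha> i. \<exists>!x. x \<in> W i \<inter> Q))"

lemma strongly_shattered_iff: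
  "strongly_shattered m U \<alpha> S \<longleftrightarrow>
    (\<exists>W. transversals m U \<alpha> W \<and> (\<Pi>\<^sub>E i\<in>{1..m}. W i) \<subseteq> S)"
  unfolding strongly_shattered_def minor_copy_def transversals_def by blast

lemma transversalsD:
  assumes "transversals m U \<alpha> W" "i \<in> {1..m}"
  shows "W i \<subseteq> U i" "Q \<in> \<alpha> i \<Longrightarrow> \<exists>!x. x \<in> W i \<inter> Q"
proof -
  have W: "W i \<subseteq> U i \<and> (\<forall>Q\<in>\<alpha> i. \<exists>!x. x \<in> W i \<inter> Q)"
    by (rule bspec[OF assms(1)[unfolded transversals_def] assms(2)])
  show "W i \<subseteq> U i"
    by (rule conjunct1[OF W])
  show "\<exists>!x. x \<in> W i \<inter> Q" if "Q \<in> \<alpha> i"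
    by (rule bspec[OF conjunct2[OF W] that])
qed

lemma strongly_shatteredI:
  assumes "\<And>i. i \<in> {1..m} \<Longrightarrow> W i \<subseteq> U i"
    and "\<And>i Q. i \<in> {1..m} \<Longrightarrow> Q \<in> \<alpha> i \<Longrightarrow> \<exists>!x. x \<in> W i \<inter> Q"
    and "(\<Pi>\<^sub>E i\<in>{1..m}. W i) \<subseteq> S"
  shows "strongly_shattered m U \<alpha> S"
proof -
  have "transversals m U \<alpha> W"
    unfolding transversals_def by (intro ballI conjI assms(1,2))
  then show ?thesis
    using assms(3) unfolding strongly_shattered_iff by blast
qed

lemma ampleE:
  assumes "ample m U S" "generalized_partition m U \<alpha>" "shattered m \<alpha> S"
  obtains W where "transversals m U \<alpha> W" "(\<Pi>\<^sub>E i\<in>{1..m}. W i) \<subseteq> S"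
  using assms unfolding ample_def strongly_shattered_iff by blast

text \<open>The elements of \<open>D = U i - A\<close> form one new block if the enlarged partition is still
  shattered. Otherwise some box over \<open>D\<close> misses \<open>S\<close>; after merging \<open>D\<close> with an old block,
  a copy cannot use an element of \<open>D\<close>, since it would meet that box.\<close>

lemma ample_restrict_factor:
  assumes ample: "ample m U S" and i: "i \<in> {1..m}" and A: "A \<subseteq> U i" "A \<noteq> {}"
  shows "ample m (U(i := A)) S"
  unfolding ample_def
proof (intro allI impI)
  fix \<beta>
  assume \<beta>: "generalized_partition m (U(i := A)) \<beta>" and sh: "shattered m \<beta> S"
  define D where "D = U i - A"
  have part: "partition_on A (\<beta> i)"
    using bspec[OF \<beta>[unfolded generalized_partition_def] i] by simp
  have gp: "generalized_partition m U (\<beta>(i := \<gamma>))" if "partition_on (U i) \<gamma>" for \<gamma>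
    using generalized_partition_upd[OF \<beta> that, of i] by simp
  have AD: "A \<union> D = U i" "D \<inter> A = {}"
    using A by (auto simp: D_def)
  show "strongly_shattered m (U(i := A)) \<beta> S"
  proof (cases "D = {}")
    case True
    then have "U(i := A) = U"
      using AD by auto
    then show ?thesis
      using ample \<beta> sh by (simp add: ample_def)
  next
    case D: False
    let ?\<alpha> = "\<beta>(i := insert D (\<beta> i))"
    have gp\<alpha>: "generalized_partition m U ?\<alpha>"
      using partition_on_insert_new[OF part AD(2) D] AD(1) by (intro gp) simp
    show ?thesis
    proof (cases "shattered m ?\<alpha> S")
      case True
      obtain W where W0: "transversals m U ?\<alpha> W" "(\<Pi>\<^sub>E j\<in>{1..m}. W j) \<subseteq> S"
        by (rule ampleE[OF ample gp\<alpha> True])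
      note W = transversalsD[OF W0(1)] W0(2)
      \<comment> \<open>The intersection drops the representative of \<open>D\<close> and keeps
        those of the old blocks, which lie in \<open>A\<close>.\<close>
      let ?W = "W(i := W i \<inter> A)"
      show ?thesis
      proof (rule strongly_shatteredI)
        show "?W j \<subseteq> (U(i := A)) j" if "j \<in> {1..m}" for j
          using W(1)[OF that] by simp
        show "\<exists>!x. x \<in> ?W j \<inter> Q" if j: "j \<in> {1..m}" and Q: "Q \<in> \<beta> j" for j Q
        proof -
          have "?W j \<inter> Q = W j \<inter> Q"
            using Q partition_onD1[OF part] by auto
          moreover have "\<exists>!x. x \<in> W j \<inter> Q"
            using Q by (intro W(2)[OF j]) auto
          ultimately show ?thesis
            by (simp only:)
        qed
        have "(\<Pi>\<^sub>E j\<in>{1..m}. ?W j) \<subseteq> (\<Pi>\<^sub>E j\<in>{1..m}. W j)"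
          by (intro PiE_mono) auto
        then show "(\<Pi>\<^sub>E j\<in>{1..m}. ?W j) \<subseteq> S"
          using W(3) by blast
      qed
    next
      case False
      then obtain P where P: "\<forall>j\<in>{1..m}. P j \<in> ?\<alpha> j"
          and missed: "S \<inter> (\<Pi>\<^sub>E j\<in>{1..m}. P j) = {}"
        unfolding shattered_iff by blast
      have Pj: "P j \<in> \<beta> j" if "j \<in> {1..m}" "j \<noteq> i" for j
        using bspec[OF P that(1)] that(2) by simp
      \<comment> \<open>Since \<open>\<beta>\<close> is shattered, a missed box must use the new
        block \<open>D\<close> in coordinate \<open>i\<close>.\<close>
      have "P i \<notin> \<beta> i"
      proof
        assume "P i \<in> \<beta> i"
        then have "P j \<in> \<beta> j" if "j \<in> {1..m}" for j
          using Pj[OF that] by (cases "j = i") auto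
        then show False
          using shatteredD[OF sh] missed by blast
      qed
      then have Pi: "P i = D"
        using bspec[OF P i] by simp
      obtain Q where Q: "Q \<in> \<beta> i"
        using partition_onD1[OF part] A(2) by blast
      let ?\<alpha>' = "\<beta>(i := insert (Q \<union> D) (\<beta> i - {Q}))"
      have QA: "Q \<subseteq> A"
        using Q partition_onD1[OF part] by blast
      have "partition_on ((A - Q) \<union> (Q \<union> D)) (insert (Q \<union> D) (\<beta> i - {Q}))"
        using AD D by (intro partition_on_insert_new partition_on_remove part Q) auto
      also have "(A - Q) \<union> (Q \<union> D) = U i"
        using QA AD by auto
      finally have gp': "generalized_partition m U ?\<alpha>'"
        by (rule gp)
      have "shattered m ?\<alpha>' S"
        unfolding shattered_iff
      proof (intro allI impI)
        fix R
        assume R: "\<forall>j\<in>{1..m}. R j \<in> ?\<alpha>' j"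
        \<comment> \<open>Shrinking the merged block back to \<open>Q\<close> gives a smaller box of
          the old partition, which \<open>S\<close> meets.\<close>
        let ?R = "R(i := if R i = Q \<union> D then Q else R i)"
        have "?R j \<in> \<beta> j" if "j \<in> {1..m}" for j
          using bspec[OF R that] Q by (cases "j = i") auto
        then have "S \<inter> (\<Pi>\<^sub>E j\<in>{1..m}. ?R j) \<noteq> {}"
          by (rule shatteredD[OF sh])
        moreover have "(\<Pi>\<^sub>E j\<in>{1..m}. ?R j) \<subseteq> (\<Pi>\<^sub>E j\<in>{1..m}. R j)"
          by (intro PiE_mono) auto
        ultimately show "S \<inter> (\<Pi>\<^sub>E j\<in>{1..m}. R j) \<noteq> {}"
          by blast
      qed
      then obtain W where W0: "transversals m U ?\<alpha>' W" "(\<Pi>\<^sub>E j\<in>{1..m}. W j) \<subseteq> S"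
        by (rule ampleE[OF ample gp'])
      note W = transversalsD[OF W0(1)] W0(2)
      have WD: "W i \<inter> D = {}"
      proof (rule ccontr)
        assume meet: "W i \<inter> D \<noteq> {}"
        have "W j \<inter> P j \<noteq> {}" if "j \<in> {1..m}" for j
        proof (cases "j = i")
          case True
          then show ?thesis
            using meet Pi by simp
        next
          case False
          then have "P j \<in> ?\<alpha>' j"
            using Pj[OF that] by simp
          then show ?thesis
            using W(2)[OF that] by blast
        qed
        then have "(\<Pi>\<^sub>E j\<in>{1..m}. W j) \<inter> (\<Pi>\<^sub>E j\<in>{1..m}. P j) \<noteq> {}"
          by (rule PiE_meet)
        then show False
          using W(3) missed by blast
      qed
      show ?thesis
      proof (rule strongly_shatteredI)
        show "W j \<subseteq> (U(i := A)) j" if "j \<in> {1..m}" for j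
          using W(1)[OF that] WD AD by auto
        show "\<exists>!x. x \<in> W j \<inter> R" if j: "j \<in> {1..m}" and R: "R \<in> \<beta> j" for j R
        proof (cases "j = i \<and> R = Q")
          case True
          have "\<exists>!x. x \<in> W i \<inter> (Q \<union> D)"
            by (intro W(2)[OF i]) simp
          moreover have "W i \<inter> (Q \<union> D) = W i \<inter> Q"
            using WD by auto
          ultimately show ?thesis
            using True by (simp only:)
        next
          case False
          then show ?thesis
            using R by (intro W(2)[OF j]) auto
        qed
      qed (fact W(3))
    qed
  qed
qed

lemma ample_cong:
  assumes "\<And>i. i \<in> {1..m} \<Longrightarrow> U i = V i"
  shows "ample m U S \<longleftrightarrow> ample m V S"
proof -
  have "generalized_partition m U \<alpha> \<longleftrightarrow> generalized_partition m V \<alpha>" for \<alpha>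
    using assms by (simp add: generalized_partition_def)
  moreover have "strongly_shattered m U \<alpha> S \<longleftrightarrow> strongly_shattered m V \<alpha> S" for \<alpha>
    using assms by (simp add: strongly_shattered_iff transversals_def)
  ultimately show ?thesis
    by (simp add: ample_def)
qed

text \<open>The factors are shrunk one at a time; \<open>K\<close> collects the coordinates already
  treated.\<close>

lemma ample_subfactors:
  assumes "ample m U S" "subfactors m U V"
  shows "ample m V S"
proof -
  have "ample m (\<lambda>j. if j \<in> K then V j else U j) S" if "finite K" "K \<subseteq> {1..m}" for K
    using that
  proof (induction K rule: finite_induct)
    case empty
    then show ?case
      using assms(1) by simp
  next
    case (insert i K)
    have "ample m ((\<lambda>j. if j \<in> K then V j else U j)(i := V i)) S"
      using insert assms(2) by (intro ample_restrict_factor) (auto simp: subfactors_def)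
    moreover have "(\<lambda>j. if j \<in> K then V j else U j)(i := V i)
        = (\<lambda>j. if j \<in> insert i K then V j else U j)"
      by (rule ext) simp
    ultimately show ?case
      by simp
  qed
  from this[of "{1..m}"] have "ample m (\<lambda>j. if j \<in> {1..m} then V j else U j) S"
    by simp
  then show ?thesis
    by (subst (asm) ample_cong[where V = V]) simp_all
qed

section \<open>Links of ample sets\<close>

text \<open>Adding \<open>{x}\<close> as a block to a partition shattered by the link gives one
  shattered by \<open>S\<close>. The \<open>i\<close>-th factor of the resulting copy contains
  \<open>x\<close>, and deleting \<open>x\<close> there leaves a copy inside the link.\<close>

lemma ample_link:
  assumes ample: "ample m U S" and i: "i \<in> {1..m}" and x: "x \<in> U i" "U i \<noteq> {x}"
  shows "ample m (U(i := U i - {x})) (link i x S)"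
  unfolding ample_def
proof (intro allI impI)
  let ?V = "U(i := U i - {x})"
  fix \<beta>
  assume \<beta>: "generalized_partition m ?V \<beta>" and sh: "shattered m \<beta> (link i x S)"
  let ?\<alpha> = "\<beta>(i := insert {x} (\<beta> i))"
  have part: "partition_on (U i - {x}) (\<beta> i)"
    using bspec[OF \<beta>[unfolded generalized_partition_def] i] by simp
  have "partition_on ((U i - {x}) \<union> {x}) (insert {x} (\<beta> i))"
    by (intro partition_on_insert_new part) auto
  also have "(U i - {x}) \<union> {x} = U i"
    using x by auto
  finally have gp: "generalized_partition m U ?\<alpha>"
    using generalized_partition_upd[OF \<beta>, of "U i" "insert {x} (\<beta> i)" i] by simp
  obtain Q where Q: "Q \<in> \<beta> i"
    using partition_onD1[OF part] x by blast
  have "shattered m ?\<alpha> S"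
    unfolding shattered_iff
  proof (intro allI impI)
    fix P
    assume P: "\<forall>j\<in>{1..m}. P j \<in> ?\<alpha> j"
    show "S \<inter> (\<Pi>\<^sub>E j\<in>{1..m}. P j) \<noteq> {}"
    proof (cases "P i = {x}")
      case True
      have "(P(i := Q)) j \<in> \<beta> j" if "j \<in> {1..m}" for j
        using bspec[OF P that] Q by (cases "j = i") auto
      \<comment> \<open>A point of the link over an old block \<open>Q\<close> can be moved to
        \<open>x\<close> without leaving \<open>S\<close>.\<close>
      then have "link i x S \<inter> (\<Pi>\<^sub>E j\<in>{1..m}. (P(i := Q)) j) \<noteq> {}"
        by (rule shatteredD[OF sh])
      from link_meet(2)[OF i this] show ?thesis
        using True by (simp only: fun_upd_upd fun_upd_idem not_False_eq_True)
    next
      case False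
      have "P j \<in> \<beta> j" if "j \<in> {1..m}" for j
        using bspec[OF P that] False by (cases "j = i") auto
      then have "link i x S \<inter> (\<Pi>\<^sub>E j\<in>{1..m}. P j) \<noteq> {}"
        by (rule shatteredD[OF sh])
      then show ?thesis
        by (rule link_meet(1)[OF i])
    qed
  qed
  then obtain W where W0: "transversals m U ?\<alpha> W" "(\<Pi>\<^sub>E j\<in>{1..m}. W j) \<subseteq> S"
    by (rule ampleE[OF ample gp])
  note W = transversalsD[OF W0(1)] W0(2)
  let ?W = "W(i := W i - {x})"
  have avoid: "R \<subseteq> U i - {x}" if "R \<in> \<beta> i" for R
    using that partition_onD1[OF part] by blast
  \<comment> \<open>The block \<open>{x}\<close> forces \<open>x\<close> into \<open>W i\<close>,
    while the representative of \<open>Q\<close> keeps \<open>W i - {x}\<close> nonempty, so that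
    the box remaining after deletion can be compared with the link.\<close>
  have "\<exists>!y. y \<in> W i \<inter> {x}" "\<exists>!y. y \<in> W i \<inter> Q"
    using Q by (intro W(2)[OF i]; simp)+
  then have xW: "x \<in> W i" and "W i \<inter> Q \<noteq> {}"
    by blast+
  then have ne: "?W i \<noteq> {}"
    using avoid[OF Q] by auto
  have "?W(i := insert x (?W i)) = W"
    using xW by (auto simp: insert_absorb)
  then have sub: "(\<Pi>\<^sub>E j\<in>{1..m}. ?W j) \<subseteq> link i x S"
    using box_insert_subset_iff[of i m ?W x S] i ne W(3) by simp
  show "strongly_shattered m ?V \<beta> (link i x S)"
  proof (rule strongly_shatteredI[OF _ _ sub])
    show "?W j \<subseteq> ?V j" if "j \<in> {1..m}" for j
      using W(1)[OF that] by auto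
    show "\<exists>!y. y \<in> ?W j \<inter> R" if j: "j \<in> {1..m}" and R: "R \<in> \<beta> j" for j R
    proof -
      have "?W j \<inter> R = W j \<inter> R"
        using R avoid by auto
      moreover have "\<exists>!y. y \<in> W j \<inter> R"
        using R by (intro W(2)[OF j]) auto
      ultimately show ?thesis
        by (simp only:)
    qed
  qed
qed

text \<open>Split \<open>U i\<close> into \<open>{x}\<close> and the rest, leaving the other factors
  whole. The two meeting hypotheses say exactly that this partition is shattered, and in a copy some
  point over the rest can be moved to \<open>x\<close>.\<close>

lemma ample_link_meet:
  assumes ample: "ample m U S" and i: "i \<in> {1..m}" and x: "x \<in> U i" "U i \<noteq> {x}"
    and ne: "\<And>j. j \<in> {1..m} \<Longrightarrow> U j \<noteq> {}"
    and V: "S \<inter> (\<Pi>\<^sub>E j\<in>{1..m}. (U(i := U i - {x})) j) \<noteq> {}"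
    and X: "S \<inter> (\<Pi>\<^sub>E j\<in>{1..m}. (U(i := {x})) j) \<noteq> {}"
  shows "link i x S \<inter> (\<Pi>\<^sub>E j\<in>{1..m}. (U(i := U i - {x})) j) \<noteq> {}"
proof -
  let ?V = "U i - {x}"
  let ?\<alpha> = "(\<lambda>j. {U j})(i := insert {x} {?V})"
  have "?V \<noteq> {}"
    using x by auto
  have "generalized_partition m U (\<lambda>j. {U j})"
    using ne by (auto simp: generalized_partition_def intro: partition_on_space)
  moreover have "partition_on (?V \<union> {x}) (insert {x} {?V})"
    using \<open>?V \<noteq> {}\<close> by (intro partition_on_insert_new partition_on_space) auto
  moreover have "?V \<union> {x} = U i"
    using x by auto
  ultimately have gp: "generalized_partition m U ?\<alpha>"
    using generalized_partition_upd[of m U "\<lambda>j. {U j}" "U i" "insert {x} {?V}" i] by simp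
  have "shattered m ?\<alpha> S"
    unfolding shattered_iff
  proof (intro allI impI)
    fix P
    assume P: "\<forall>j\<in>{1..m}. P j \<in> ?\<alpha> j"
    have Pj: "P j = U j" if "j \<in> {1..m}" "j \<noteq> i" for j
      using bspec[OF P that(1)] that(2) by simp
    have "(\<Pi>\<^sub>E j\<in>{1..m}. P j) = (\<Pi>\<^sub>E j\<in>{1..m}. (U(i := P i)) j)"
      using Pj by (intro PiE_cong) auto
    moreover have "P i = {x} \<or> P i = ?V"
      using bspec[OF P i] by auto
    ultimately show "S \<inter> (\<Pi>\<^sub>E j\<in>{1..m}. P j) \<noteq> {}"
      using V X by metis
  qed
  then obtain W where W0: "transversals m U ?\<alpha> W" "(\<Pi>\<^sub>E j\<in>{1..m}. W j) \<subseteq> S"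
    by (rule ampleE[OF ample gp])
  note W = transversalsD[OF W0(1)] W0(2)
  have "\<exists>!y. y \<in> W i \<inter> {x}"
    by (intro W(2)[OF i]) simp
  then have "x \<in> W i"
    by blast
  have "W j \<inter> (U(i := ?V)) j \<noteq> {}" if "j \<in> {1..m}" for j
  proof -
    have "\<exists>!y. y \<in> W j \<inter> (U(i := ?V)) j"
      by (intro W(2)[OF that]) simp
    then show ?thesis
      by blast
  qed
  then have "(\<Pi>\<^sub>E j\<in>{1..m}. W j) \<inter> (\<Pi>\<^sub>E j\<in>{1..m}. (U(i := ?V)) j) \<noteq> {}"
    by (rule PiE_meet)
  then obtain s where s: "s \<in> (\<Pi>\<^sub>E j\<in>{1..m}. W j)" "s \<in> (\<Pi>\<^sub>E j\<in>{1..m}. (U(i := ?V)) j)"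
    by blast
  have "s(i := x) \<in> (\<Pi>\<^sub>E j\<in>{1..m}. W j)"
    using s(1) \<open>x \<in> W i\<close> i by (auto simp: PiE_iff extensional_def)
  then have "s \<in> link i x S"
    using s(1) W(3) by (auto simp: link_def)
  then show ?thesis
    using s(2) by blast
qed

section \<open>The equivalence\<close>

text \<open>This is the decrease of the measure in both inductions.\<close>

lemma sum_card_upd_less:
  fixes U :: "nat \<Rightarrow> 'a set"
  assumes "\<And>j. j \<in> {1..m} \<Longrightarrow> finite (U j)" "i \<in> {1..m}" "A \<subset> U i"
  shows "(\<Sum>j\<in>{1..m}. card ((U(i := A)) j)) < (\<Sum>j\<in>{1..m}. card (U j))"
proof (rule sum_strict_mono_ex1)
  show "\<forall>j\<in>{1..m}. card ((U(i := A)) j) \<le> card (U j)"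
    using assms by (auto intro: card_mono)
  show "\<exists>j\<in>{1..m}. card ((U(i := A)) j) < card (U j)"
    using assms by (intro bexI[of _ i]) (auto intro: psubset_card_mono)
qed simp

section \<open>From ampleness to Euler characteristic one\<close>

text \<open>The recursion evaluates to \<open>1 + 1 - 1\<close> if the link meets the product
  without \<open>x\<close>. Otherwise \<open>S\<close> meets exactly one of the two parts, and it
  gives \<open>1 + 0 - 0\<close> or \<open>0 + 1 - 0\<close>.\<close>

lemma ample_imp_box_sum:
  fixes U :: "nat \<Rightarrow> 'a set"
  assumes "\<And>i. i \<in> {1..m} \<Longrightarrow> finite (U i)" "ample m U S" "S \<inter> (\<Pi>\<^sub>E i\<in>{1..m}. U i) \<noteq> {}"
  shows "box_sum m U S = 1"
  using assms
proof (induction "\<Sum>i\<in>{1..m}. card (U i)" arbitrary: U S rule: less_induct)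
  case less
  note fin = less.prems(1) and ample = less.prems(2) and meet = less.prems(3)
  have ne: "U i \<noteq> {}" if "i \<in> {1..m}" for i
    using meet that by (auto simp: PiE_iff)
  have IH: "box_sum m (U(i := A)) S' = 1"
    if "i \<in> {1..m}" "A \<subset> U i" "ample m (U(i := A)) S'"
      "S' \<inter> (\<Pi>\<^sub>E j\<in>{1..m}. (U(i := A)) j) \<noteq> {}" for i A S'
  proof (rule less.hyps)
    show "(\<Sum>j\<in>{1..m}. card ((U(i := A)) j)) < (\<Sum>j\<in>{1..m}. card (U j))"
      using fin that by (intro sum_card_upd_less)
    show "finite ((U(i := A)) j)" if "j \<in> {1..m}" for j
      using fin[OF that] fin \<open>i \<in> {1..m}\<close> \<open>A \<subset> U i\<close> finite_subset[of A "U i"] by auto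
  qed (fact that(3,4))+
  show ?case
  proof (cases "\<forall>i\<in>{1..m}. \<exists>a. U i = {a}")
    case True
    then show ?thesis
      using meet by (intro box_sum_point) auto
  next
    case False
    \<comment> \<open>This factor has at least two elements, so both \<open>U i - {x}\<close> and
      \<open>{x}\<close> are nonempty proper subsets and the induction hypothesis applies to
      each.\<close>
    then obtain i where i: "i \<in> {1..m}" and not1: "\<nexists>a. U i = {a}"
      by blast
    obtain x where x: "x \<in> U i"
      using ne[OF i] by blast
    let ?V = "U(i := U i - {x})" and ?X = "U(i := {x})" and ?T = "link i x S"
    have sub: "U i - {x} \<subset> U i" "{x} \<subset> U i" "U i - {x} \<noteq> {}" "U i \<noteq> {x}"
      using x not1 by blast+
    have amples: "ample m ?V S" "ample m ?X S" "ample m ?V ?T"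
      using sub x i ample by (auto intro!: ample_restrict_factor ample_link)
    have split: "box_sum m U S = box_sum m ?V S + box_sum m ?X S - box_sum m ?V ?T"
      using fin i x by (intro box_sum_split)
    have some: "S \<inter> (\<Pi>\<^sub>E j\<in>{1..m}. ?V j) \<noteq> {} \<or> S \<inter> (\<Pi>\<^sub>E j\<in>{1..m}. ?X j) \<noteq> {}"
    proof -
      obtain s where s: "s \<in> S" "s \<in> (\<Pi>\<^sub>E j\<in>{1..m}. U j)"
        using meet by blast
      then have "s \<in> (\<Pi>\<^sub>E j\<in>{1..m}. ?V j) \<or> s \<in> (\<Pi>\<^sub>E j\<in>{1..m}. ?X j)"
        by (cases "s i = x") (auto simp: PiE_iff)
      then show ?thesis
        using s(1) by blast
    qed
    show ?thesis
    proof (cases "?T \<inter> (\<Pi>\<^sub>E j\<in>{1..m}. ?V j) = {}")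
      case True
      have "\<not> (S \<inter> (\<Pi>\<^sub>E j\<in>{1..m}. ?V j) \<noteq> {} \<and> S \<inter> (\<Pi>\<^sub>E j\<in>{1..m}. ?X j) \<noteq> {})"
        using ample_link_meet[OF ample i x sub(4) ne] True by blast
      then consider
          "S \<inter> (\<Pi>\<^sub>E j\<in>{1..m}. ?V j) = {}" "S \<inter> (\<Pi>\<^sub>E j\<in>{1..m}. ?X j) \<noteq> {}"
        | "S \<inter> (\<Pi>\<^sub>E j\<in>{1..m}. ?X j) = {}" "S \<inter> (\<Pi>\<^sub>E j\<in>{1..m}. ?V j) \<noteq> {}"
        using some by blast
      then show ?thesis
      proof cases
        case 1
        show ?thesis
          unfolding split box_sum_empty[OF True] box_sum_empty[OF 1(1)]
            IH[OF i sub(2) amples(2) 1(2)] by simp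
      next
        case 2
        show ?thesis
          unfolding split box_sum_empty[OF True] box_sum_empty[OF 2(1)]
            IH[OF i sub(1) amples(1) 2(2)] by simp
      qed
    next
      case False
      have "S \<inter> (\<Pi>\<^sub>E j\<in>{1..m}. (?V(i := {x})) j) \<noteq> {}"
        by (rule link_meet(2)[OF i False])
      then have "S \<inter> (\<Pi>\<^sub>E j\<in>{1..m}. ?X j) \<noteq> {}"
        by (simp only: fun_upd_upd not_False_eq_True)
      from IH[OF i sub(2) amples(2) this] IH[OF i sub(1) amples(3) False]
        IH[OF i sub(1) amples(1) link_meet(1)[OF i False]]
      show ?thesis
        unfolding split by simp
    qed
  qed
qed

section \<open>From Euler characteristic one to ampleness\<close>

text \<open>Apply the recursion to \<open>B\<close> with \<open>x\<close> added to factor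
  \<open>i\<close>: three of its four terms are 1 by hypothesis, hence so is the link term. In
  particular the link meets \<open>B\<close>.\<close>

lemma box_sum_link:
  assumes fin: "\<And>j. j \<in> {1..m} \<Longrightarrow> finite (U j)"
    and one: "\<And>B. subfactors m U B \<Longrightarrow> S \<inter> (\<Pi>\<^sub>E j\<in>{1..m}. B j) \<noteq> {} \<Longrightarrow> box_sum m B S = 1"
    and i: "i \<in> {1..m}" and x: "x \<in> U i" and B: "subfactors m (U(i := U i - {x})) B"
    and meet: "S \<inter> (\<Pi>\<^sub>E j\<in>{1..m}. B j) \<noteq> {}" "S \<inter> (\<Pi>\<^sub>E j\<in>{1..m}. (B(i := {x})) j) \<noteq> {}"
  shows "box_sum m B (link i x S) = 1"
proof -
  let ?C = "B(i := insert x (B i))"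
  have "B i \<subseteq> U i - {x}"
    using bspec[OF B[unfolded subfactors_def] i] by simp
  then have C: "?C i - {x} = B i" "x \<in> ?C i"
    by auto
  have Bj: "B j \<noteq> {} \<and> B j \<subseteq> U j" if "j \<in> {1..m}" for j
    using bspec[OF B[unfolded subfactors_def] that] by (auto split: if_splits)
  have sub: "subfactors m U B" "subfactors m U (B(i := {x}))" "subfactors m U ?C"
    using Bj x by (auto simp: subfactors_def)
  have "(\<Pi>\<^sub>E j\<in>{1..m}. B j) \<subseteq> (\<Pi>\<^sub>E j\<in>{1..m}. ?C j)"
    by (intro PiE_mono) auto
  then have "S \<inter> (\<Pi>\<^sub>E j\<in>{1..m}. ?C j) \<noteq> {}"
    using meet(1) by blast
  from one[OF sub(3) this] have "box_sum m ?C S = 1" .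
  moreover have "finite (?C j)" if "j \<in> {1..m}" for j
    using fin[OF that] finite_subset[of "?C j" "U j"] bspec[OF sub(3)[unfolded subfactors_def] that]
    by blast
  from box_sum_split[of m ?C i x S, OF this i C(2)]
  have "box_sum m ?C S = box_sum m B S + box_sum m (B(i := {x})) S - box_sum m B (link i x S)"
    unfolding C(1) by simp
  moreover have "box_sum m B S = 1" "box_sum m (B(i := {x})) S = 1"
    using one sub meet by blast+
  ultimately show ?thesis
    by simp
qed

text \<open>Restricting one factor to a block \<open>Q\<close> yields, by induction, a point \<open>y \<in> Q\<close> whose slice
  meets all boxes over the other coordinates. If \<open>Q\<close> has further points, delete them and use
  induction again; if \<open>Q = {y}\<close>, use induction on the link of \<open>y\<close>.\<close>

lemma box_sum_imp_ample:
  fixes U :: "nat \<Rightarrow> 'a set"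
  assumes "\<And>i. i \<in> {1..m} \<Longrightarrow> finite (U i)" "\<And>i. i \<in> {1..m} \<Longrightarrow> U i \<noteq> {}"
    and "\<And>B. subfactors m U B \<Longrightarrow> S \<inter> (\<Pi>\<^sub>E i\<in>{1..m}. B i) \<noteq> {} \<Longrightarrow> box_sum m B S = 1"
  shows "ample m U S"
  using assms
proof (induction "\<Sum>i\<in>{1..m}. card (U i)" arbitrary: U S rule: less_induct)
  case less
  note fin = less.prems(1) and ne = less.prems(2) and one = less.prems(3)
  have IH: "ample m (U(i := A)) S'"
    if "i \<in> {1..m}" "A \<subset> U i" "A \<noteq> {}"
      "\<And>B. subfactors m (U(i := A)) B \<Longrightarrow> S' \<inter> (\<Pi>\<^sub>E i\<in>{1..m}. B i) \<noteq> {} \<Longrightarrow> box_sum m B S' = 1"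
    for i A S'
  proof (rule less.hyps)
    show "(\<Sum>j\<in>{1..m}. card ((U(i := A)) j)) < (\<Sum>j\<in>{1..m}. card (U j))"
      using fin that by (intro sum_card_upd_less)
    show "finite ((U(i := A)) j)" if "j \<in> {1..m}" for j
      using fin[OF that] fin \<open>i \<in> {1..m}\<close> \<open>A \<subset> U i\<close> finite_subset[of A "U i"] by auto
    show "(U(i := A)) j \<noteq> {}" if "j \<in> {1..m}" for j
      using ne[OF that] \<open>A \<noteq> {}\<close> by simp
  qed (fact that(4))
  \<comment> \<open>Boxes of a smaller product are boxes of \<open>U\<close>, so \<open>S\<close>
    keeps its hypothesis.\<close>
  have IH_same: "ample m (U(i := A)) S" if "i \<in> {1..m}" "A \<subset> U i" "A \<noteq> {}" for i A
  proof (rule IH[OF that one])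
    show "subfactors m U B" if "subfactors m (U(i := A)) B" for B
      using that \<open>A \<subset> U i\<close> unfolding subfactors_def by (auto split: if_splits)
  qed
  show ?case
    unfolding ample_def
  proof (intro allI impI)
    fix \<alpha>
    assume \<alpha>: "generalized_partition m U \<alpha>" and sh: "shattered m \<alpha> S"
    have part: "partition_on (U i) (\<alpha> i)" if "i \<in> {1..m}" for i
      using \<alpha> that by (auto simp: generalized_partition_def)
    show "strongly_shattered m U \<alpha> S"
    proof (cases "\<forall>i\<in>{1..m}. \<alpha> i = {U i}")
      case True
      then have "S \<inter> (\<Pi>\<^sub>E i\<in>{1..m}. U i) \<noteq> {}"
        by (intro shatteredD[OF sh]) auto
      \<comment> \<open>If all partitions are trivial, a copy is a single point.\<close>
      then obtain s where s: "s \<in> S" "s \<in> (\<Pi>\<^sub>E i\<in>{1..m}. U i)"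
        by blast
      have "(\<Pi>\<^sub>E i\<in>{1..m}. {s i}) = {s}"
        using s(2) by (intro PiE_singleton) (auto simp: PiE_iff)
      then show ?thesis
        using s True by (intro strongly_shatteredI[of m "\<lambda>i. {s i}"]) (auto simp: PiE_iff)
    next
      case False
      then obtain i where i: "i \<in> {1..m}" and nontriv: "\<alpha> i \<noteq> {U i}"
        by blast
      have "\<alpha> i \<noteq> {}"
        using part[OF i] ne[OF i] by (auto simp: partition_on_def)
      then obtain Q where Q: "Q \<in> \<alpha> i" "Q \<noteq> U i"
        using nontriv by blast
      have Qsub: "Q \<subset> U i" and Qne: "Q \<noteq> {}"
        using Q part[OF i] by (auto simp: partition_on_def)
      have gpQ: "generalized_partition m (U(i := Q)) (\<alpha>(i := {Q}))"
        by (intro generalized_partition_upd \<alpha> partition_on_space Qne)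
      have shQ: "shattered m (\<alpha>(i := {Q})) S"
        unfolding shattered_iff
      proof (intro allI impI)
        fix P
        assume P: "\<forall>j\<in>{1..m}. P j \<in> (\<alpha>(i := {Q})) j"
        have "P j \<in> \<alpha> j" if "j \<in> {1..m}" for j
          using bspec[OF P that] Q by (cases "j = i") auto
        then show "S \<inter> (\<Pi>\<^sub>E j\<in>{1..m}. P j) \<noteq> {}"
          by (rule shatteredD[OF sh])
      qed
      obtain Z where Z0: "transversals m (U(i := Q)) (\<alpha>(i := {Q})) Z" "(\<Pi>\<^sub>E j\<in>{1..m}. Z j) \<subseteq> S"
        by (rule ampleE[OF IH_same[OF i Qsub Qne] gpQ shQ])
      note Z = transversalsD[OF Z0(1)] Z0(2)
      have "\<exists>!y. y \<in> Z i \<inter> Q"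
        by (intro Z(2)[OF i]) simp
      then obtain y where y: "y \<in> Z i" "y \<in> Q"
        by blast
      \<comment> \<open>For \<open>j \<noteq> i\<close> the factor \<open>Z j\<close> meets every
        block of \<open>\<alpha> j\<close>, so the copy has a point with \<open>y\<close> in
        coordinate \<open>i\<close> and the other coordinates in prescribed blocks.\<close>
      have slice: "S \<inter> (\<Pi>\<^sub>E j\<in>{1..m}. (P(i := {y})) j) \<noteq> {}"
        if P: "\<And>j. j \<in> {1..m} \<Longrightarrow> j \<noteq> i \<Longrightarrow> P j \<in> \<alpha> j" for P
      proof -
        have "Z j \<inter> (P(i := {y})) j \<noteq> {}" if "j \<in> {1..m}" for j
        proof (cases "j = i")
          case True
          then show ?thesis
            using y by simp
        next
          case False
          then have "\<exists>!x. x \<in> Z j \<inter> P j"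
            using P[OF that] by (intro Z(2)[OF that]) simp
          then show ?thesis
            using False by auto
        qed
        then have "(\<Pi>\<^sub>E j\<in>{1..m}. Z j) \<inter> (\<Pi>\<^sub>E j\<in>{1..m}. (P(i := {y})) j) \<noteq> {}"
          by (rule PiE_meet)
        then show ?thesis
          using Z(3) by blast
      qed
      have yU: "y \<in> U i"
        using y Qsub by blast
      have rest: "partition_on (U i - Q) (\<alpha> i - {Q})"
        by (rule partition_on_remove[OF part[OF i] Q(1)])
      have avoid: "R \<subseteq> U i - Q" if "R \<in> \<alpha> i" "R \<noteq> Q" for R
        using that partition_onD1[OF rest] by blast
      show ?thesis
      proof (cases "Q = {y}")
        case False
        \<comment> \<open>Here \<open>y\<close> alone replaces the block \<open>Q\<close>. The
          factor shrinks because \<open>Q\<close> has another element, and boxes over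
          \<open>{y}\<close> are met by \<open>slice\<close>.\<close>
        let ?A = "(U i - Q) \<union> {y}" and ?\<beta> = "\<alpha>(i := insert {y} (\<alpha> i - {Q}))"
        have A: "?A \<subset> U i" "?A \<noteq> {}"
          using False y Qsub by auto
        have gp: "generalized_partition m (U(i := ?A)) ?\<beta>"
          using y by (intro generalized_partition_upd \<alpha> partition_on_insert_new rest) auto
        have "shattered m ?\<beta> S"
          unfolding shattered_iff
        proof (intro allI impI)
          fix P
          assume P: "\<forall>j\<in>{1..m}. P j \<in> ?\<beta> j"
          have Pj: "P j \<in> \<alpha> j" if "j \<in> {1..m}" "j \<noteq> i" for j
            using bspec[OF P that(1)] that(2) by simp
          show "S \<inter> (\<Pi>\<^sub>E j\<in>{1..m}. P j) \<noteq> {}"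
          proof (cases "P i = {y}")
            case True
            then show ?thesis
              using slice[OF Pj] by (simp add: fun_upd_idem)
          next
            case False
            then have "P j \<in> \<alpha> j" if "j \<in> {1..m}" for j
              using bspec[OF P that] by (cases "j = i") auto
            then show ?thesis
              by (rule shatteredD[OF sh])
          qed
        qed
        then obtain W where W0: "transversals m (U(i := ?A)) ?\<beta> W" "(\<Pi>\<^sub>E j\<in>{1..m}. W j) \<subseteq> S"
          by (rule ampleE[OF IH_same[OF i A] gp])
        note W = transversalsD[OF W0(1)] W0(2)
        show ?thesis
        proof (rule strongly_shatteredI)
          show "W j \<subseteq> U j" if "j \<in> {1..m}" for j
            using W(1)[OF that] A(1) by (cases "j = i") auto
          show "\<exists>!x. x \<in> W j \<inter> R" if j: "j \<in> {1..m}" and R: "R \<in> \<alpha> j" for j R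
          proof (cases "j = i \<and> R = Q")
            case True
            have "\<exists>!x. x \<in> W i \<inter> {y}"
              by (intro W(2)[OF i]) simp
            \<comment> \<open>Since \<open>y\<close> is the only element of \<open>Q\<close> left in
              \<open>?A\<close>, a transversal of the new partition is one of the old.\<close>
            moreover have "W i \<inter> {y} = W i \<inter> Q"
              using W(1)[OF i] y by auto
            ultimately show ?thesis
              using True by (simp only:)
          next
            case False
            then show ?thesis
              using R by (intro W(2)[OF j]) auto
          qed
        qed (fact W(3))
      next
        case Qy: True
        let ?V = "U(i := U i - {y})" and ?\<beta> = "\<alpha>(i := \<alpha> i - {Q})"
        have Vi: "U i - {y} \<subset> U i" "U i - {y} \<noteq> {}"
          using Qy Qsub by auto
        \<comment> \<open>Only meetings with \<open>S\<close> are assumed. This serves twice: for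
          the induction hypothesis on the link, and to show that the link is nonempty on the boxes
          of the partition.\<close>
        have link_one: "box_sum m B (link i y S) = 1"
          if "subfactors m ?V B" "S \<inter> (\<Pi>\<^sub>E j\<in>{1..m}. B j) \<noteq> {}"
            "S \<inter> (\<Pi>\<^sub>E j\<in>{1..m}. (B(i := {y})) j) \<noteq> {}" for B
          by (rule box_sum_link[OF _ _ i yU that]) (fact fin, fact one)
        have "box_sum m B (link i y S) = 1"
          if "subfactors m ?V B" "link i y S \<inter> (\<Pi>\<^sub>E j\<in>{1..m}. B j) \<noteq> {}" for B
          by (rule link_one[OF that(1) link_meet[OF i that(2)]])
        then have ample_link: "ample m ?V (link i y S)"
          by (intro IH[OF i Vi])
        have gp: "generalized_partition m ?V ?\<beta>"
          using rest Qy by (intro generalized_partition_upd \<alpha>) simp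
        have "shattered m ?\<beta> (link i y S)"
          unfolding shattered_iff
        proof (intro allI impI)
          fix P
          assume P: "\<forall>j\<in>{1..m}. P j \<in> ?\<beta> j"
          have P\<alpha>: "P j \<in> \<alpha> j" if "j \<in> {1..m}" for j
            using bspec[OF P that] by (cases "j = i") auto
          have "P j \<noteq> {} \<and> P j \<subseteq> ?V j" if "j \<in> {1..m}" for j
            using gp bspec[OF P that] that by (auto simp only: generalized_partition_def partition_on_def)
          then have "subfactors m ?V P"
            by (simp only: subfactors_def) blast
          \<comment> \<open>The box of \<open>P\<close> is met because \<open>\<alpha>\<close> is
            shattered, its translate to \<open>y\<close> because of \<open>slice\<close>; a value
            other than 0 then yields a point of the link.\<close>
          then have "box_sum m P (link i y S) = 1"
            using P\<alpha> by (intro link_one shatteredD[OF sh] slice)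
          then show "link i y S \<inter> (\<Pi>\<^sub>E j\<in>{1..m}. P j) \<noteq> {}"
            using box_sum_empty[of "link i y S" m P] by (metis zero_neq_one)
        qed
        then obtain W where W0: "transversals m ?V ?\<beta> W" "(\<Pi>\<^sub>E j\<in>{1..m}. W j) \<subseteq> link i y S"
          by (rule ampleE[OF ample_link gp])
        note W = transversalsD[OF W0(1)] W0(2)
        let ?W = "W(i := insert y (W i))"
        \<comment> \<open>As \<open>Q\<close> is a proper block, another block exists; its
          representative makes \<open>W i\<close> nonempty, which is needed for adding
          \<open>y\<close> to the copy.\<close>
        obtain R where R: "R \<in> \<alpha> i" "R \<noteq> Q"
          using partition_onD1[OF rest] Qsub by blast
        then have "\<exists>!x. x \<in> W i \<inter> R"
          by (intro W(2)[OF i]) simp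
        then have "W i \<noteq> {}"
          by blast
        have yW: "y \<notin> W i"
          using W(1)[OF i] by auto
        show ?thesis
        proof (rule strongly_shatteredI)
          show "?W j \<subseteq> U j" if "j \<in> {1..m}" for j
            using W(1)[OF that] yU by (cases "j = i") auto
          show "\<exists>!x. x \<in> ?W j \<inter> R" if j: "j \<in> {1..m}" and R: "R \<in> \<alpha> j" for j R
          proof (cases "j = i \<and> R = Q")
            case True
            then show ?thesis
              using Qy by auto
          next
            case False
            then have "\<exists>!x. x \<in> W j \<inter> R"
              using R by (intro W(2)[OF j]) auto
            moreover have "?W j \<inter> R = W j \<inter> R"
              using False R avoid[of R] y by auto
            ultimately show ?thesis
              by (simp only:)
          qed
          show "(\<Pi>\<^sub>E j\<in>{1..m}. ?W j) \<subseteq> S"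
            using box_insert_subset_iff[of i m W y S] i \<open>W i \<noteq> {}\<close> W(3) by simp
        qed
      qed
    qed
  qed
qed

declare One_nat_def [simp]

theorem theorem5:
  fixes m :: nat and U :: "nat \<Rightarrow> 'a set" and S :: "(nat \<Rightarrow> 'a) set"
  assumes "\<And>i. i \<in> {1..m} \<Longrightarrow> finite (U i)"
    and "\<And>i. i \<in> {1..m} \<Longrightarrow> U i \<noteq> {}"
    and "S \<subseteq> (\<Pi>\<^sub>E i\<in>{1..m}. U i)"
  shows "ample m U S \<longleftrightarrow>
    (\<forall>V. full_dim_subproduct m U V \<and> S \<inter> V \<noteq> {} \<longrightarrow> euler_char m U (S \<inter> V) = 1)"
proof -
  have "(\<forall>V. full_dim_subproduct m U V \<and> S \<inter> V \<noteq> {} \<longrightarrow> euler_char m U (S \<inter> V) = 1) \<longleftrightarrow>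
      (\<forall>B. subfactors m U B \<longrightarrow> S \<inter> (\<Pi>\<^sub>E i\<in>{1..m}. B i) \<noteq> {} \<longrightarrow>
        euler_char m U (S \<inter> (\<Pi>\<^sub>E i\<in>{1..m}. B i)) = 1)"
    unfolding full_dim_subproduct_def by blast
  also have "\<dots> \<longleftrightarrow>
      (\<forall>B. subfactors m U B \<longrightarrow> S \<inter> (\<Pi>\<^sub>E i\<in>{1..m}. B i) \<noteq> {} \<longrightarrow> box_sum m B S = 1)"
    using euler_char_eq_box_sum[OF assms(1)] by simp
  also have "\<dots> \<longleftrightarrow> ample m U S"
  proof
    assume "\<forall>B. subfactors m U B \<longrightarrow> S \<inter> (\<Pi>\<^sub>E i\<in>{1..m}. B i) \<noteq> {} \<longrightarrow> box_sum m B S = 1"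
    then show "ample m U S"
      using assms(1,2) by (intro box_sum_imp_ample) auto
  next
    assume ample: "ample m U S"
    show "\<forall>B. subfactors m U B \<longrightarrow> S \<inter> (\<Pi>\<^sub>E i\<in>{1..m}. B i) \<noteq> {} \<longrightarrow> box_sum m B S = 1"
    proof (intro allI impI)
      fix B
      assume B: "subfactors m U B" and meet: "S \<inter> (\<Pi>\<^sub>E i\<in>{1..m}. B i) \<noteq> {}"
      have "finite (B i)" if "i \<in> {1..m}" for i
        using bspec[OF B[unfolded subfactors_def] that] assms(1)[OF that] finite_subset by blast
      \<comment> \<open>Ampleness passes to the box \<open>B\<close>, which then takes the role of
        the whole product.\<close>
      then show "box_sum m B S = 1"
        using ample_subfactors[OF ample B] meet by (intro ample_imp_box_sum)
    qed
  qed
  finally show ?thesis ..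
qed

end
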